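(* Let $k\ge1$ and let $V$ be any level $k$ integrable module of $U_q(\hat{\mathfrak{sl}}(2))$. Then the correlation functions of $x^-(z)x^-(w)$ on $V$ have at most poles at $zq^{2}=w$ (that is, they have no poles with $z,w\neq0$ other than possibly along $zq^{2}=w$).
   Context: Here $q$ is generic (a formal parameter; the base field is $\mathbb{C}(q)$ with $q^{1/2}$ adjoined). Drinfeld's current realization: $U_q(\hat{\mathfrak{sl}}(2))$ is the associative unital algebra with generators $\varphi(-m),\psi(m)$ ($m\in\mathbb{Z}_{\ge0}$), $x^{\pm}(l)$ ($l\in\mathbb{Z}$) and a central element $c$ (entering through $q^{\pm c/2}$), with $\varphi(0),\psi(0)$ invertible and mutually inverse. Put $x^{\pm}(z)=\sum_{l\in\mathbb{Z}}x^{\pm}(l)z^{-l}$, $\varphi(z)=\sum_{m\in-\mathbb{Z}_{\ge0}}\varphi(m)z^{-m}$, $\psi(z)=\sum_{m\in\mathbb{Z}_{\ge0}}\psi(m)z^{-m}$. The defining relations are - $\varphi(z)\varphi(w)=\varphi(w)\varphi(z)$, $\psi(z)\psi(w)=\psi(w)\psi(z)$, - $\varphi(z)\psi(w)\varphi(z)^{-1}\psi(w)^{-1}=\dfrac{g(\frac zw q^{-c})}{g(\frac zw q^{c})}$, - $\varphi(z)x^{\pm}(w)\varphi(z)^{-1}=g(\frac zw q^{\mp c/2})^{\pm1}x^{\pm}(w)$, - $\psi(z)x^{\pm}(w)\psi(z)^{-1}=g(\frac wz q^{\mp c/2})^{\mp1}x^{\pm}(w)$, - $[x^+(z),x^-(w)]=\frac{1}{q-q^{-1}}\{\delta(\frac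 zw q^{-c})\psi(wq^{c/2})-\delta(\frac zw q^{c})\varphi(zq^{c/2})\}$, - $(z-q^{\pm2}w)x^{\pm}(z)x^{\pm}(w)=(q^{\pm2}z-w)x^{\pm}(w)x^{\pm}(z)$, where $\delta(z)=\sum_{j\in\mathbb{Z}}z^j$ and $g(z)=\frac{q^2z-1}{z-q^2}$ is expanded about $z=0$. A level $k$ integrable module means an integrable highest weight module (with respect to the standard identification of this algebra with the Drinfeld–Jimbo algebra $U_q(\hat{\mathfrak{sl}}(2))$: highest weight dominant integral, Chevalley generators acting locally nilpotently) on which $c$ acts as the scalar $k$. The correlation functions of $x^-(z)x^-(w)$ on $V$ are its matrix coefficients $\langle v^*, x^-(z)x^-(w)v\rangle$, for $v\in V$ and $v^*$ in the restricted (weight-graded) dual of $V$. Each is a formal Laurent series understood as the expansion, in the region $|z|\gg|w|$, of a rational function; poles are those of this rational function at nonzero $z,w$ (so "no poles" means a Laurent polynomial in $z,w$). *)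

theory Defs
  imports
    "HOL-Library.Poly_Mapping"
    "HOL-Computational_Algebra.Computational_Algebra"
    "HOL-Algebra.Algebraic_Closure_Type"
begin

section \<open>The base field\<close>

text \<open>The field \<open>\<complex>(q)\<close> with \<open>q\<^sup>1\<^sup>/\<^sup>2\<close> adjoined is \<open>\<complex>(s)\<close> with \<open>s = q\<^sup>1\<^sup>/\<^sup>2\<close> transcendental.\<close>

type_synonym base = "complex poly fract"

definition q_half :: base where
  "q_half = Fract [:0, 1:] 1"

definition qq :: base where
  "qq = q_half ^ 2"

section \<open>The algebra in Drinfeld's current realization\<close>

text \<open>
  \<open>Phi m\<close> stands for \<open>\<phi>(-m)\<close>, \<open>Psi m\<close> for \<open>\<psi>(m)\<close>, \<open>Xp l\<close> and \<open>Xm l\<close> for \<open>x\<^sup>+(l)\<close> and \<open>x\<^sup>-(l)\<close>,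
  \<open>Gam\<close> and \<open>GamInv\<close> for \<open>q\<^bsup>c/2\<^esup>\<close> and \<open>q\<^bsup>-c/2\<^esup>\<close>.
\<close>

datatype gen = Phi nat | Psi nat | Xp int | Xm int | Gam | GamInv

text \<open>Words under concatenation; the free algebra is their monoid algebra.\<close>

datatype gword = Word (letters: "gen list")

instantiation gword :: monoid_add
begin

definition zero_gword :: gword where
  "0 = Word []"

definition plus_gword :: "gword \<Rightarrow> gword \<Rightarrow> gword" where
  "u + v = Word (letters u @ letters v)"

instance
  by standard (simp_all add: zero_gword_def plus_gword_def)

end

type_synonym free_alg = "gword \<Rightarrow>\<^sub>0 base"

definition fgen :: "gen \<Rightarrow> free_alg" where
  "fgen g = Poly_Mapping.single (Word [g]) 1"

definition fconst :: "base \<Rightarrow> free_alg" where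
  "fconst a = Poly_Mapping.single 0 a"

abbreviation xp :: "int \<Rightarrow> free_alg" where
  "xp l \<equiv> fgen (Xp l)"

abbreviation xm :: "int \<Rightarrow> free_alg" where
  "xm l \<equiv> fgen (Xm l)"

definition phi :: "int \<Rightarrow> free_alg" where
  "phi m = (if m \<le> 0 then fgen (Phi (nat (- m))) else 0)"

definition psi :: "int \<Rightarrow> free_alg" where
  "psi m = (if 0 \<le> m then fgen (Psi (nat m)) else 0)"

text \<open>\<open>gam j\<close> is \<open>q\<^bsup>jc/2\<^esup>\<close>.\<close>

definition gam :: "int \<Rightarrow> free_alg" where
  "gam j = (if 0 \<le> j then fgen Gam ^ nat j else fgen GamInv ^ nat (- j))"

text \<open>\<open>g(t) = (q\<^sup>2 t - 1) / (t - q\<^sup>2)\<close>, expanded about \<open>t = 0\<close>; its constant term is \<open>q\<^sup>-\<^sup>2\<close>.\<close>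

definition g_ser :: "base fps" where
  "g_ser = (fps_const (qq ^ 2) * fps_X - 1) / (fps_X - fps_const (qq ^ 2))"

text \<open>The coefficient of \<open>t\<^sup>j\<close> in \<open>g(t q\<^sup>-\<^sup>c) / g(t q\<^sup>c)\<close>.\<close>

definition g_quot :: "nat \<Rightarrow> free_alg" where
  "g_quot j = (\<Sum>i\<le>j. fconst (fps_nth g_ser i * fps_nth (inverse g_ser) (j - i))
      * gam (- 2 * int i) * gam (2 * int (j - i)))"

text \<open>
  The coefficients of the defining relations. The relations that involve inverses of currents,
  such as \<open>\<phi>(z) x(w) \<phi>(z)\<^sup>-\<^sup>1 = h(z/w) x(w)\<close>, are multiplied out to
  \<open>\<phi>(z) x(w) = h(z/w) x(w) \<phi>(z)\<close>; the series \<open>\<phi>(z)\<close> in \<open>z\<close> and \<open>\<psi>(z)\<close> in \<open>z\<^sup>-\<^sup>1\<close> are invertible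
  because \<open>\<phi>(0)\<close> and \<open>\<psi>(0)\<close> are. The coefficients compared are those of
  \<open>z\<^sup>a w\<^sup>-\<^sup>b\<close> in \<open>phi_psi\<close>, of \<open>z\<^sup>a w\<^sup>-\<^sup>l\<close> in \<open>phi_xp\<close> and \<open>phi_xm\<close>, of \<open>z\<^sup>-\<^sup>b w\<^sup>-\<^sup>l\<close> in \<open>psi_xp\<close> and \<open>psi_xm\<close>,
  and of \<open>z\<^sup>-\<^sup>l w\<^sup>-\<^sup>n\<close> in the last three.
\<close>

inductive drinfeld_rel :: "free_alg \<Rightarrow> free_alg \<Rightarrow> bool" where
  gam_inv1: "drinfeld_rel (fgen Gam * fgen GamInv) 1"
| gam_inv2: "drinfeld_rel (fgen GamInv * fgen Gam) 1"
| gam_central: "drinfeld_rel (fgen Gam * fgen a) (fgen a * fgen Gam)"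
| phi_psi_inv: "drinfeld_rel (phi 0 * psi 0) 1"
| psi_phi_inv: "drinfeld_rel (psi 0 * phi 0) 1"
| phi_phi: "drinfeld_rel (phi m * phi n) (phi n * phi m)"
| psi_psi: "drinfeld_rel (psi m * psi n) (psi n * psi m)"
| phi_psi: "drinfeld_rel (phi (- int a) * psi (int b))
    (\<Sum>j\<le>min a b. g_quot j * psi (int b - int j) * phi (int j - int a))"
| phi_xp: "drinfeld_rel (phi (- int a) * xp l)
    (\<Sum>j\<le>a. fconst (fps_nth g_ser j) * gam (- int j) * xp (l - int j) * phi (int j - int a))"
| phi_xm: "drinfeld_rel (phi (- int a) * xm l)
    (\<Sum>j\<le>a. fconst (fps_nth (inverse g_ser) j) * gam (int j) * xm (l - int j) * phi (int j - int a))"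
| psi_xp: "drinfeld_rel (psi (int b) * xp l)
    (\<Sum>j\<le>b. fconst (fps_nth (inverse g_ser) j) * gam (- int j) * xp (l + int j) * psi (int b - int j))"
| psi_xm: "drinfeld_rel (psi (int b) * xm l)
    (\<Sum>j\<le>b. fconst (fps_nth g_ser j) * gam (int j) * xm (l + int j) * psi (int b - int j))"
| xp_xm: "drinfeld_rel (xp l * xm n - xm n * xp l)
    (fconst (1 / (qq - inverse qq)) * (gam (l - n) * psi (l + n) - gam (n - l) * phi (l + n)))"
| xp_xp: "drinfeld_rel (xp (l + 1) * xp n - fconst (qq ^ 2) * xp l * xp (n + 1))
    (fconst (qq ^ 2) * xp n * xp (l + 1) - xp (n + 1) * xp l)"
| xm_xm: "drinfeld_rel (xm (l + 1) * xm n - fconst (inverse qq ^ 2) * xm l * xm (n + 1))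
    (fconst (inverse qq ^ 2) * xm n * xm (l + 1) - xm (n + 1) * xm l)"

inductive_set drinfeld_ideal :: "free_alg set" where
  zero: "0 \<in> drinfeld_ideal"
| rel: "drinfeld_rel a b \<Longrightarrow> x * (a - b) * y \<in> drinfeld_ideal"
| add: "a \<in> drinfeld_ideal \<Longrightarrow> b \<in> drinfeld_ideal \<Longrightarrow> a + b \<in> drinfeld_ideal"

lemma drinfeld_ideal_mult:
  assumes "a \<in> drinfeld_ideal"
  shows "x * a * y \<in> drinfeld_ideal"
  using assms
proof induction
  case (rel a b u v)
  have "x * (u * (a - b) * v) * y = (x * u) * (a - b) * (v * y)"
    by (simp add: mult.assoc)
  then show ?case
    using drinfeld_ideal.rel[OF rel, of "x * u" "v * y"] by simp
qed (auto simp: distrib_left distrib_right intro: drinfeld_ideal.intros)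

lemma drinfeld_ideal_uminus: "a \<in> drinfeld_ideal \<Longrightarrow> - a \<in> drinfeld_ideal"
  using drinfeld_ideal_mult[of a "- 1" 1] by simp

definition drinfeld_eq :: "free_alg \<Rightarrow> free_alg \<Rightarrow> bool" where
  "drinfeld_eq a b \<longleftrightarrow> a - b \<in> drinfeld_ideal"

lemma equivp_drinfeld_eq: "equivp drinfeld_eq"
proof (rule equivpI)
  show "reflp drinfeld_eq"
    by (simp add: reflp_def drinfeld_eq_def drinfeld_ideal.zero)
  show "symp drinfeld_eq"
    unfolding symp_def drinfeld_eq_def by (metis drinfeld_ideal_uminus minus_diff_eq)
  show "transp drinfeld_eq"
  proof (rule transpI, unfold drinfeld_eq_def)
    fix a b c :: free_alg
    assume "a - b \<in> drinfeld_ideal" "b - c \<in> drinfeld_ideal"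
    from drinfeld_ideal.add[OF this] show "a - c \<in> drinfeld_ideal" by simp
  qed
qed

text \<open>\<open>uq\<close> is \<open>U\<^sub>q\<close> of the affine Lie algebra of type \<open>A\<^sub>1\<^sup>(\<^sup>1\<^sup>)\<close> (without derivation).\<close>

quotient_type uq = free_alg / drinfeld_eq
  by (rule equivp_drinfeld_eq)

instantiation uq :: "{ring, monoid_mult}"
begin

lift_definition zero_uq :: uq is 0 .

lift_definition one_uq :: uq is 1 .

lift_definition plus_uq :: "uq \<Rightarrow> uq \<Rightarrow> uq" is "(+)"
  unfolding drinfeld_eq_def by (metis add_diff_add drinfeld_ideal.add)

lift_definition uminus_uq :: "uq \<Rightarrow> uq" is uminus
  unfolding drinfeld_eq_def by (metis drinfeld_ideal_uminus minus_diff_minus)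

lift_definition minus_uq :: "uq \<Rightarrow> uq \<Rightarrow> uq" is "(-)"
proof -
  fix a b c d :: free_alg
  assume "drinfeld_eq a b" "drinfeld_eq c d"
  then have "(a - b) + (- (c - d)) \<in> drinfeld_ideal"
    unfolding drinfeld_eq_def by (intro drinfeld_ideal.add drinfeld_ideal_uminus)
  then show "drinfeld_eq (a - c) (b - d)"
    unfolding drinfeld_eq_def by (simp add: algebra_simps)
qed

lift_definition times_uq :: "uq \<Rightarrow> uq \<Rightarrow> uq" is "(*)"
proof -
  fix a b c d :: free_alg
  assume "drinfeld_eq a b" "drinfeld_eq c d"
  then have "1 * (a - b) * c + b * (c - d) * 1 \<in> drinfeld_ideal"
    unfolding drinfeld_eq_def by (intro drinfeld_ideal.add drinfeld_ideal_mult)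
  then show "drinfeld_eq (a * c) (b * d)"
    unfolding drinfeld_eq_def by (simp add: algebra_simps)
qed

instance
  by standard
    (transfer, simp add: algebra_simps equivp_reflp[OF equivp_drinfeld_eq])+

end

lift_definition uq_gen :: "gen \<Rightarrow> uq" is fgen .

lift_definition uq_const :: "base \<Rightarrow> uq" is fconst .

lift_definition uq_word :: "gword \<Rightarrow> uq" is "\<lambda>u. Poly_Mapping.single u 1" .

text \<open>
  The Chevalley generators \<open>e\<^sub>i\<close>, \<open>f\<^sub>i\<close>, \<open>K\<^sub>i\<close> under the standard identification, with \<open>K = \<psi>(0)\<close>:
  \<open>e\<^sub>1 = x\<^sup>+(0)\<close>, \<open>f\<^sub>1 = x\<^sup>-(0)\<close>, \<open>K\<^sub>1 = K\<close>,
  \<open>e\<^sub>0 = x\<^sup>-(1) K\<^sup>-\<^sup>1\<close>, \<open>f\<^sub>0 = K x\<^sup>+(-1)\<close>, \<open>K\<^sub>0 = q\<^sup>c K\<^sup>-\<^sup>1\<close>.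
\<close>

definition chev_e :: "nat \<Rightarrow> uq" where
  "chev_e i = (if i = 0 then uq_gen (Xm 1) * uq_gen (Phi 0) else uq_gen (Xp 0))"

definition chev_f :: "nat \<Rightarrow> uq" where
  "chev_f i = (if i = 0 then uq_gen (Psi 0) * uq_gen (Xp (- 1)) else uq_gen (Xm 0))"

definition chev_K :: "nat \<Rightarrow> uq" where
  "chev_K i = (if i = 0 then uq_gen Gam ^ 2 * uq_gen (Phi 0) else uq_gen (Psi 0))"

section \<open>Modules\<close>

locale uq_module =
  fixes act :: "uq \<Rightarrow> 'v::ab_group_add \<Rightarrow> 'v"
  assumes act_add_left: "act (a + b) v = act a v + act b v"
    and act_add_right: "act a (v + w) = act a v + act a w"
    and act_mult: "act (a * b) v = act a (act b v)"
    and act_one: "act 1 v = v"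

definition uq_scale :: "(uq \<Rightarrow> 'v::ab_group_add \<Rightarrow> 'v) \<Rightarrow> base \<Rightarrow> 'v \<Rightarrow> 'v" where
  "uq_scale act a v = act (uq_const a) v"

lemma (in uq_module) vector_space_uq_scale: "vector_space (uq_scale act)"
proof
  fix a b :: base and v w :: 'v
  show "uq_scale act a (v + w) = uq_scale act a v + uq_scale act a w"
    by (simp add: uq_scale_def act_add_right)
  have "uq_const (a + b) = uq_const a + uq_const b"
    by transfer (simp add: fconst_def single_add equivp_reflp[OF equivp_drinfeld_eq])
  then show "uq_scale act (a + b) v = uq_scale act a v + uq_scale act b v"
    by (simp add: uq_scale_def act_add_left)
  have "uq_const a * uq_const b = uq_const (a * b)"
    by transfer (simp add: fconst_def mult_single equivp_reflp[OF equivp_drinfeld_eq])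
  then show "uq_scale act a (uq_scale act b v) = uq_scale act (a * b) v"
    by (simp add: uq_scale_def act_mult[symmetric])
  have "uq_const 1 = 1"
    by transfer (simp add: fconst_def equivp_reflp[OF equivp_drinfeld_eq])
  then show "uq_scale act 1 v = v"
    by (simp add: uq_scale_def act_one)
qed

text \<open>Integrable highest weight modules of level \<open>k\<close> with highest weight vector \<open>v0\<close>.\<close>

locale level_integrable_module = uq_module act
  for act :: "uq \<Rightarrow> 'v::ab_group_add \<Rightarrow> 'v" +
  fixes k :: nat and v0 :: 'v
  assumes v0_nonzero: "v0 \<noteq> 0"
    and generated: "\<exists>a. v = act a v0"
    and highest: "i \<in> {0, 1} \<Longrightarrow> act (chev_e i) v0 = 0"
    and dominant_integral:
      "i \<in> {0, 1} \<Longrightarrow> \<exists>m::nat. act (chev_K i) v0 = uq_scale act (qq ^ m) v0"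
    and e_locally_nilpotent: "i \<in> {0, 1} \<Longrightarrow> \<exists>n. act (chev_e i ^ n) v = 0"
    and f_locally_nilpotent: "i \<in> {0, 1} \<Longrightarrow> \<exists>n. act (chev_f i ^ n) v = 0"
    and level: "act (uq_gen Gam) v = uq_scale act (q_half ^ k) v"

text \<open>
  Weights are taken in the full affine weight lattice: \<open>(a, d)\<close> stands for
  \<open>\<Lambda> + a \<alpha> + d \<delta>\<close>, where \<open>\<Lambda>\<close> is the highest weight, \<open>\<alpha>\<close> the finite simple root and \<open>x\<^sup>\<plusminus>(l)\<close> has weight
  \<open>\<plusminus>\<alpha> + l \<delta>\<close>. The \<open>\<delta>\<close>-component is needed: the joint eigenspaces of \<open>K\<^sub>0, K\<^sub>1\<close> alone are
  infinite-dimensional.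
\<close>

fun gen_weight :: "gen \<Rightarrow> int \<times> int" where
  "gen_weight (Phi m) = (0, - int m)"
| "gen_weight (Psi m) = (0, int m)"
| "gen_weight (Xp l) = (1, l)"
| "gen_weight (Xm l) = (- 1, l)"
| "gen_weight Gam = (0, 0)"
| "gen_weight GamInv = (0, 0)"

definition word_weight :: "gword \<Rightarrow> int \<times> int" where
  "word_weight u = (sum_list (map (fst \<circ> gen_weight) (letters u)),
                    sum_list (map (snd \<circ> gen_weight) (letters u)))"

definition weight_space ::
    "(uq \<Rightarrow> 'v::ab_group_add \<Rightarrow> 'v) \<Rightarrow> 'v \<Rightarrow> int \<times> int \<Rightarrow> 'v set" where
  "weight_space act v0 \<beta> =
     Modules.module.span (uq_scale act) {act (uq_word u) v0 |u. word_weight u = \<beta>}"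

text \<open>The restricted dual: the direct sum of the duals of the weight spaces.\<close>

definition restricted_dual ::
    "(uq \<Rightarrow> 'v::ab_group_add \<Rightarrow> 'v) \<Rightarrow> 'v \<Rightarrow> ('v \<Rightarrow> base) set" where
  "restricted_dual act v0 =
     {f. Vector_Spaces.linear (uq_scale act) (*) f \<and>
         finite {\<beta>. \<exists>v\<in>weight_space act v0 \<beta>. f v \<noteq> 0}}"

text \<open>The coefficient of \<open>z\<^sup>-\<^sup>l w\<^sup>-\<^sup>n\<close> in \<open>\<langle>v\<^sup>*, x\<^sup>-(z) x\<^sup>-(w) v\<rangle>\<close>.\<close>

definition correlation ::
    "(uq \<Rightarrow> 'v \<Rightarrow> 'v) \<Rightarrow> ('v \<Rightarrow> base) \<Rightarrow> 'v \<Rightarrow> int \<Rightarrow> int \<Rightarrow> base" where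
  "correlation act vs v l n = vs (act (uq_gen (Xm l)) (act (uq_gen (Xm n)) v))"

section \<open>Rational functions in two variables\<close>

text \<open>In \<open>base poly poly\<close> the inner variable is \<open>z\<close> and the outer variable is \<open>w\<close>.\<close>

type_synonym ratfun = "base poly poly fract"

text \<open>
  The region \<open>|z| \<ggreater> |w|\<close> corresponds to the field of Laurent series in \<open>w\<close> whose coefficients are
  Laurent series in \<open>z\<^sup>-\<^sup>1\<close>. It is \<open>base fls fls\<close>, with outer variable \<open>w\<close> and inner variable \<open>z\<^sup>-\<^sup>1\<close>.
\<close>

definition laurent_of_poly :: "base poly poly \<Rightarrow> base fls fls" where
  "laurent_of_poly p =
     poly (map_poly (\<lambda>c. fls_const (poly (map_poly fls_const c) fls_X_inv)) p) fls_X"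

text \<open>
  \<open>F l n\<close> is the coefficient of \<open>z\<^sup>-\<^sup>l w\<^sup>-\<^sup>n\<close>. As \<open>laurent_of_poly\<close> is an embedding of
  the polynomials into a field, \<open>F\<close> determines \<open>R\<close> and vice versa.
\<close>

definition is_expansion :: "(int \<Rightarrow> int \<Rightarrow> base) \<Rightarrow> ratfun \<Rightarrow> bool" where
  "is_expansion F R \<longleftrightarrow>
     (\<exists>a b. b \<noteq> 0 \<and> R = Fract a b \<and>
        (\<forall>l n. F l n = fls_nth (fls_nth (laurent_of_poly a / laurent_of_poly b) (- n)) l))"

definition eval2 :: "base poly poly \<Rightarrow> base alg_closure \<Rightarrow> base alg_closure \<Rightarrow> base alg_closure" where
  "eval2 p z w = poly (map_poly (\<lambda>c. poly (map_poly to_ac c) z) p) w"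

text \<open>
  The point \<open>(z, w)\<close> over the algebraic closure is a pole if \<open>R\<close> is not regular there, i.e. no
  fraction representing \<open>R\<close> has a denominator that is nonzero at \<open>(z, w)\<close>.
\<close>

definition pole_at :: "ratfun \<Rightarrow> base alg_closure \<Rightarrow> base alg_closure \<Rightarrow> bool" where
  "pole_at R z w \<longleftrightarrow> (\<forall>a b. b \<noteq> 0 \<longrightarrow> R = Fract a b \<longrightarrow> eval2 b z w = 0)"

end

theory Submission
  imports Defs
begin

text \<open>
  Call a vector smooth if \<open>x\<^sup>\<plusminus>(n)\<close> and \<open>\<psi>(n)\<close> annihilate it for all large \<open>n\<close>. The highest weight vector
  is smooth, and the relations show that every generator preserves smoothness, so all vectors are
  smooth. Put \<open>F(z,w) = \<langle>v\<^sup>*, x\<^sup>-(z) x\<^sup>-(w) v\<rangle>\<close>. Powers of \<open>w\<close> are bounded below in \<open>F(z,w)\<close>, and powers of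
  \<open>z\<close> are bounded below in \<open>F(w,z)\<close>, and only finitely many total degrees occur because \<open>v\<^sup>*\<close> lies in
  the restricted dual. By the quadratic relation
  \<open>(q\<^sup>2 z - w) F(z,w) = (z - q\<^sup>2 w) F(w,z)\<close>, hence this series is a Laurent polynomial, and \<open>F\<close> is the
  expansion of a Laurent polynomial divided by \<open>q\<^sup>2 z - w\<close>.
\<close>

section \<open>The action of the free algebra\<close>

lemma fconst_commute: "fconst c * x = x * fconst c"
proof (induction x rule: update_induct)
  case const
  show ?case by simp
next
  case (update f u a)
  have "Poly_Mapping.update u a f = Poly_Mapping.single u a + f"
    using update by (intro poly_mapping_eqI)
      (auto simp: lookup_update lookup_add lookup_single when_def in_keys_iff)
  then show ?case
    using update by (simp add: distrib_left distrib_right fconst_def mult_single mult.commute)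
qed

text \<open>Keeping the scalar apart from the word allows words to be treated letter by letter
  through \<open>single_word_Cons\<close>.\<close>

lemma free_alg_induct [case_names zero monomial add]:
  assumes "P 0" "\<And>c u. P (fconst c * Poly_Mapping.single u 1)"
    and "\<And>a b. P a \<Longrightarrow> P b \<Longrightarrow> P (a + b)"
  shows "P (x :: free_alg)"
proof (induction x rule: update_induct)
  case const
  show ?case by (rule assms)
next
  case (update f u a)
  have "Poly_Mapping.update u a f = fconst a * Poly_Mapping.single u 1 + f"
    using update by (intro poly_mapping_eqI)
      (auto simp: lookup_update lookup_add lookup_single when_def in_keys_iff fconst_def mult_single)
  then show ?case
    using update assms by simp
qed

lemma single_word_Cons:
  "Poly_Mapping.single (Word (g # gs)) (1::base) = fgen g * Poly_Mapping.single (Word gs) 1"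
  by (simp add: fgen_def mult_single plus_gword_def)

lemma gam_0 [simp]: "gam 0 = 1"
  by (simp add: gam_def)

section \<open>Genericity of \<open>q\<close> and the coefficients of \<open>g\<close>\<close>

lemma q_half_power: "q_half ^ n = Fract ([:0, 1:] ^ n) 1"
  by (induction n) (simp_all add: q_half_def One_fract_def)

lemma qq_nonzero: "qq \<noteq> 0"
proof -
  have "q_half \<noteq> 0"
    unfolding q_half_def Zero_fract_def by (subst eq_fract) auto
  then show ?thesis
    by (simp add: qq_def)
qed

lemma qq_power_4_neq_1: "qq ^ 4 \<noteq> 1"
proof
  assume "qq ^ 4 = 1"
  then have "Fract ([:0, 1 :: complex:] ^ 8) 1 = Fract 1 1"
    using q_half_power[of 8] by (simp add: qq_def One_fract_def flip: power_mult)
  then have "[:0, 1 :: complex:] ^ 8 = 1"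
    by (simp add: eq_fract)
  then have "degree ([:0, 1 :: complex:] ^ 8) = 0"
    by (metis degree_1)
  then show False
    by (simp add: degree_power_eq)
qed

text \<open>Comparing coefficients in \<open>g(t) (t - q^2) = q^2 t - 1\<close> gives
  \<open>q^-2\<close> and \<open>q^-4 - 1\<close> for \<open>g\<close>. The constant terms are
  divided out in the smoothness arguments, the linear terms when modes are raised on the highest
  weight vector.\<close>

lemma g_ser_coeffs: "fps_nth g_ser 0 \<noteq> 0" "fps_nth (inverse g_ser) 0 \<noteq> 0"
    "fps_nth g_ser 1 \<noteq> 0" "fps_nth (inverse g_ser) 1 \<noteq> 0"
proof -
  define c where "c = qq ^ 2"
  have c: "c \<noteq> 0" "c * c \<noteq> 1"
    using qq_nonzero qq_power_4_neq_1 by (simp_all add: c_def flip: power_add)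
  have "g_ser * (fps_X - fps_const c) = fps_const c * fps_X - 1"
    using c(1) by (simp add: g_ser_def fps_divide_unit mult.assoc inverse_mult_eq_1 flip: c_def)
  then have "fps_nth (g_ser * (fps_X - fps_const c)) n = fps_nth (fps_const c * fps_X - 1) n" for n
    by simp
  from this[of 0] this[of 1] have g: "c * fps_nth g_ser 0 = 1" "fps_nth g_ser 0 - c * fps_nth g_ser 1 = c"
    by (simp_all add: fps_mult_nth_0 fps_mult_nth_1 algebra_simps)
  show g0: "fps_nth g_ser 0 \<noteq> 0"
    using g(1) by auto
  show g1: "fps_nth g_ser 1 \<noteq> 0"
    using g c by auto
  have "fps_nth (inverse g_ser * g_ser) 1 = 0"
    using g0 by (simp add: inverse_mult_eq_1)
  then have "fps_nth (inverse g_ser) 0 * fps_nth g_ser 1 + fps_nth (inverse g_ser) 1 * fps_nth g_ser 0 = 0"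
    by (simp add: fps_mult_nth_1)
  then show "fps_nth (inverse g_ser) 0 \<noteq> 0" "fps_nth (inverse g_ser) 1 \<noteq> 0"
    using g0 g1 by auto
qed

context uq_module
begin

text \<open>Acting through representatives lets the defining relations be applied as stated and
  vectors be expanded in words.\<close>

definition actf :: "free_alg \<Rightarrow> 'v \<Rightarrow> 'v" where
  "actf x v = act (abs_uq x) v"

lemma actf_add: "actf (x + y) v = actf x v + actf y v"
  by (simp add: actf_def act_add_left plus_uq.abs_eq[symmetric])

lemma actf_add_right: "actf x (v + w) = actf x v + actf x w"
  by (simp add: actf_def act_add_right)

lemma actf_mult: "actf (x * y) v = actf x (actf y v)"
  by (simp add: actf_def act_mult times_uq.abs_eq[symmetric])

lemma actf_one [simp]: "actf 1 v = v"
  by (simp add: actf_def act_one one_uq.abs_eq[symmetric])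

lemma actf_zero_left [simp]: "actf 0 v = 0"
  using actf_add[of 0 0 v] by simp

lemma actf_zero_right [simp]: "actf x 0 = 0"
  using actf_add_right[of x 0 0] by simp

lemma actf_diff: "actf (x - y) v = actf x v - actf y v"
  using actf_add[of "x - y" y v] by simp

lemma actf_sum: "actf (sum f S) v = (\<Sum>i\<in>S. actf (f i) v)"
  by (induction S rule: infinite_finite_induct) (simp_all add: actf_add)

lemma actf_fconst_eq_0:
  assumes "actf (fconst c) v = 0" "c \<noteq> 0"
  shows "v = 0"
proof -
  have "fconst (inverse c) * fconst c = 1"
    using assms(2) by (simp add: fconst_def mult_single)
  then have "v = actf (fconst (inverse c)) (actf (fconst c) v)"
    by (simp flip: actf_mult)
  then show ?thesis
    using assms(1) by simp
qed

lemma uq_scale_eq_actf: "uq_scale act c v = actf (fconst c) v"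
  by (simp add: uq_scale_def actf_def uq_const.abs_eq)

lemma act_gen: "act (uq_gen g) v = actf (fgen g) v"
  by (simp add: actf_def uq_gen.abs_eq)

lemma act_word: "act (uq_word u) v = actf (Poly_Mapping.single u 1) v"
  by (simp add: actf_def uq_word.abs_eq)

lemma actf_rel:
  assumes "drinfeld_rel a b"
  shows "actf a v = actf b v"
proof -
  have "drinfeld_eq a b"
    using drinfeld_ideal.rel[OF assms, of 1 1] by (simp add: drinfeld_eq_def)
  then have "abs_uq a = abs_uq b"
    by (simp add: uq.abs_eq_iff)
  then show ?thesis
    by (simp add: actf_def)
qed

section \<open>Smooth vectors\<close>

definition ev_kills :: "(int \<Rightarrow> free_alg) \<Rightarrow> 'v \<Rightarrow> bool" where
  "ev_kills y v \<longleftrightarrow> (\<forall>\<^sub>F n in at_top. actf (y n) v = 0)"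

text \<open>\<open>psi\<close> is included because commuting \<open>xp\<close> past
  \<open>xm\<close> produces \<open>psi\<close> modes; the \<open>phi\<close> modes it also produces
  vanish at positive index.\<close>

definition smooth :: "'v \<Rightarrow> bool" where
  "smooth v \<longleftrightarrow> ev_kills xp v \<and> ev_kills xm v \<and> ev_kills psi v"

lemma ev_kills_shift:
  assumes "ev_kills y v"
  shows "\<forall>\<^sub>F n in at_top. actf (y (n + e)) v = 0" "\<forall>\<^sub>F n in at_top. actf (y (e + n)) v = 0"
proof -
  obtain N where N: "actf (y n) v = 0" if "n \<ge> N" for n
    using assms by (auto simp: ev_kills_def eventually_at_top_linorder)
  then show "\<forall>\<^sub>F n in at_top. actf (y (n + e)) v = 0"
    by (auto simp: eventually_at_top_linorder intro!: exI[of _ "N - e"])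
  then show "\<forall>\<^sub>F n in at_top. actf (y (e + n)) v = 0"
    by (simp add: add.commute)
qed

text \<open>
  All relations of the form \<open>p y(l) = \<Sum>\<^sub>j t\<^sub>j y(l + e\<^sub>j) p\<^sub>j\<close> are used to push \<open>y(l)\<close> through \<open>p\<^sub>0\<close>: the
  leading term is expressed by the others.
\<close>
lemma ev_kills_leading_term:
  fixes a :: nat and e :: "nat \<Rightarrow> int"
  assumes rel: "\<forall>\<^sub>F l in at_top. actf (p * y l) v = actf (\<Sum>j\<le>a. t j * y (l + e j) * p' j) v"
    and t0: "t 0 = fconst c" "c \<noteq> 0" and e0: "e 0 = 0"
    and v: "ev_kills y v"
    and lower: "\<And>j. j \<in> {1..a} \<Longrightarrow> ev_kills y (actf (p' j) v)"
  shows "ev_kills y (actf (p' 0) v)"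
proof -
  have "\<forall>\<^sub>F l in at_top. \<forall>j\<in>{1..a}. actf (y (l + e j)) (actf (p' j) v) = 0"
    using lower by (intro eventually_ball_finite) (auto intro: ev_kills_shift)
  moreover have "\<forall>\<^sub>F l in at_top. actf (y l) v = 0"
    using v by (simp add: ev_kills_def)
  ultimately show ?thesis
    unfolding ev_kills_def using rel
  proof eventually_elim
    case (elim l)
    have "{..a} = insert 0 {1..a}" by auto
    then have "0 = actf (t 0) (actf (y l) (actf (p' 0) v)) +
        (\<Sum>j\<in>{1..a}. actf (t j) (actf (y (l + e j)) (actf (p' j) v)))"
      using elim by (simp add: actf_add actf_sum actf_mult e0)
    also have "(\<Sum>j\<in>{1..a}. actf (t j) (actf (y (l + e j)) (actf (p' j) v))) = 0"
      using elim by (intro sum.neutral) simp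
    finally show ?case
      using actf_fconst_eq_0 t0 by simp
  qed
qed

section \<open>Preservation of smoothness by the generators\<close>

lemma g_quot_0: "g_quot 0 = fconst 1"
  using g_ser_coeffs by (simp add: g_quot_def)

text \<open>Strong induction on \<open>a\<close>: the terms with \<open>j >= 1\<close> involve
  \<open>phi\<close> modes of smaller depth, so \<open>ev_kills_leading_term\<close> applies to each
  of the three currents.\<close>

lemma smooth_phi:
  assumes "smooth v"
  shows "smooth (actf (phi (- int a)) v)"
  using assms
proof (induction a rule: less_induct)
  case (less a)
  have lower: "smooth (actf (phi (int j - int a)) v)" if "j \<in> {1..a}" for j
    using less.IH[of "a - j"] less.prems that by (auto simp: of_nat_diff)
  have "ev_kills xp (actf (phi (int 0 - int a)) v)"
    by (rule ev_kills_leading_term[where p = "phi (- int a)" and a = a and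
          t = "\<lambda>j. fconst (fps_nth g_ser j) * gam (- int j)" and e = "\<lambda>j. - int j" and
          p' = "\<lambda>j. phi (int j - int a)" and c = "fps_nth g_ser 0"])
      (use less.prems lower g_ser_coeffs actf_rel[OF phi_xp] in \<open>auto simp: smooth_def\<close>)
  moreover have "ev_kills xm (actf (phi (int 0 - int a)) v)"
    by (rule ev_kills_leading_term[where p = "phi (- int a)" and a = a and
          t = "\<lambda>j. fconst (fps_nth (inverse g_ser) j) * gam (int j)" and e = "\<lambda>j. - int j" and
          p' = "\<lambda>j. phi (int j - int a)" and c = "fps_nth (inverse g_ser) 0"])
      (use less.prems lower g_ser_coeffs actf_rel[OF phi_xm] in \<open>auto simp: smooth_def\<close>)
  \<comment> \<open>The sum in \<open>phi_psi\<close> stops at \<open>min a l\<close>, which is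
    \<open>a\<close> once \<open>l >= a\<close>.\<close>
  moreover have "\<forall>\<^sub>F l in at_top. actf (phi (- int a) * psi l) v =
      actf (\<Sum>j\<le>a. g_quot j * psi (l + - int j) * phi (int j - int a)) v"
    using eventually_ge_at_top[of "int a"]
  proof eventually_elim
    case (elim l)
    then show ?case
      using actf_rel[OF phi_psi[of a "nat l"], of v] by (simp add: min_absorb1 nat_le_iff le_nat_iff)
  qed
  then have "ev_kills psi (actf (phi (int 0 - int a)) v)"
    by (rule ev_kills_leading_term[where c = 1])
      (use less.prems lower g_quot_0 in \<open>auto simp: smooth_def\<close>)
  ultimately show ?case
    by (simp add: smooth_def)
qed

lemma smooth_psi:
  assumes "smooth v"
  shows "smooth (actf (psi (int b)) v)"
  using assms
proof (induction b rule: less_induct)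
  case (less b)
  have lower: "smooth (actf (psi (int b - int j)) v)" if "j \<in> {1..b}" for j
    using less.IH[of "b - j"] less.prems that by (auto simp: of_nat_diff)
  have "ev_kills xp (actf (psi (int b - int 0)) v)"
    by (rule ev_kills_leading_term[where p = "psi (int b)" and a = b and
          t = "\<lambda>j. fconst (fps_nth (inverse g_ser) j) * gam (- int j)" and e = int and
          p' = "\<lambda>j. psi (int b - int j)" and c = "fps_nth (inverse g_ser) 0"])
      (use less.prems lower g_ser_coeffs actf_rel[OF psi_xp] in \<open>auto simp: smooth_def\<close>)
  moreover have "ev_kills xm (actf (psi (int b - int 0)) v)"
    by (rule ev_kills_leading_term[where p = "psi (int b)" and a = b and
          t = "\<lambda>j. fconst (fps_nth g_ser j) * gam (int j)" and e = int and
          p' = "\<lambda>j. psi (int b - int j)" and c = "fps_nth g_ser 0"])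
      (use less.prems lower g_ser_coeffs actf_rel[OF psi_xm] in \<open>auto simp: smooth_def\<close>)
  moreover have "ev_kills psi (actf (psi (int b)) v)"
    using less.prems actf_rel[OF psi_psi[where n = "int b"], where v = v]
    by (auto simp: smooth_def ev_kills_def actf_mult elim: eventually_mono)
  ultimately show ?case
    by (simp add: smooth_def)
qed

text \<open>
  The quadratic relation turns \<open>y(n) y(l) v\<close> into \<open>d\<^sup>j y(n - j) y(l + j) v\<close> as long as \<open>n - j\<close> is large,
  and the latter vanishes once \<open>l + j\<close> is large.
\<close>
lemma ev_kills_same_current:
  assumes rel: "\<And>l n. actf (y (l + 1) * y n - fconst d * y l * y (n + 1)) v =
      actf (fconst d * y n * y (l + 1) - y (n + 1) * y l) v"
    and v: "ev_kills y v"
  shows "ev_kills y (actf (y l) v)"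
proof -
  obtain N where N: "actf (y n) v = 0" if "n \<ge> N" for n
    using v by (auto simp: ev_kills_def eventually_at_top_linorder)
  have *: "\<forall>n\<ge>N + int i. actf (y n) (actf (y l) v) = 0" if "l \<ge> N - int i" for i l
    using that
  proof (induction i arbitrary: l)
    case 0
    then show ?case by (simp add: N)
  next
    case (Suc i)
    show ?case
    proof (intro allI impI)
      fix n assume n: "n \<ge> N + int (Suc i)"
      have "actf (y (n - 1)) (actf (y (l + 1)) v) = 0"
        using Suc.IH[of "l + 1"] Suc.prems n by simp
      \<comment> \<open>In the relation for the modes \<open>n - 1\<close> and \<open>l\<close> the
        right side vanishes because \<open>n - 1 >= N\<close>.\<close>
      then show "actf (y n) (actf (y l) v) = 0"
        using rel[of "n - 1" l] n by (simp add: actf_diff actf_mult N)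
    qed
  qed
  have "\<forall>n\<ge>N + int (nat (N - l)). actf (y n) (actf (y l) v) = 0"
    by (rule *) linarith
  then show ?thesis
    unfolding ev_kills_def eventually_at_top_linorder by blast
qed

text \<open>Here the mode of \<open>psi\<close> grows while that of \<open>y\<close> is fixed, so no
  leading term is isolated. In each summand either \<open>psi (b - j)\<close> already kills
  \<open>v\<close>, or \<open>b - j\<close> is one of finitely many small values and the mode
  \<open>l + j\<close> is large.\<close>

lemma ev_kills_psi_current:
  assumes rel: "\<And>b. actf (psi (int b) * y l) v =
      actf (\<Sum>j\<le>b. t j * y (l + int j) * psi (int b - int j)) v"
    and v: "smooth v" and y: "\<And>w. smooth w \<Longrightarrow> ev_kills y w"
  shows "ev_kills psi (actf (y l) v)"
proof -
  have "ev_kills psi v" using v by (simp add: smooth_def)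
  then obtain N where "\<forall>n\<ge>N. actf (psi n) v = 0"
    by (auto simp: ev_kills_def eventually_at_top_linorder)
  then have N: "actf (psi n) v = 0" if "n \<ge> int (nat N)" for n
  proof -
    have "N \<le> n" using that by linarith
    then show ?thesis using \<open>\<forall>n\<ge>N. actf (psi n) v = 0\<close> by blast
  qed
  have "\<forall>\<^sub>F m in at_top. \<forall>i\<in>{..<nat N}. actf (y m) (actf (psi (int i)) v) = 0"
    using y smooth_psi[OF v] by (intro eventually_ball_finite) (auto simp: ev_kills_def)
  then obtain M where M: "actf (y m) (actf (psi (int i)) v) = 0" if "m \<ge> M" "i < nat N" for m i
    by (auto simp: eventually_at_top_linorder)
  \<comment> \<open>With \<open>b - j < nat N\<close> this bound forces
    \<open>l + j >= M\<close>.\<close>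
  have "actf (psi n) (actf (y l) v) = 0" if n: "n \<ge> max 0 (int (nat N) + M - l)" for n
  proof -
    define b where "b = nat n"
    have nb: "n = int b" using n by (simp add: b_def)
    have "actf (y (l + int j)) (actf (psi (int b - int j)) v) = 0" if "j \<le> b" for j
    proof (cases "b - j < nat N")
      case True
      moreover have "l + int j \<ge> M"
        using True n nb by linarith
      ultimately show ?thesis
        using M[of "l + int j" "b - j"] that by (simp add: of_nat_diff)
    next
      case False
      then have "int b - int j \<ge> int (nat N)"
        using that by linarith
      then show ?thesis
        using N by simp
    qed
    then show ?thesis
      using rel[of b] by (simp add: actf_sum actf_mult nb)
  qed
  then show ?thesis
    unfolding ev_kills_def eventually_at_top_linorder by blast
qed

lemma ev_phi_0: "\<forall>\<^sub>F n in at_top. phi (n + l) = 0"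
  by (auto simp: phi_def eventually_at_top_linorder intro!: exI[of _ "1 - l"])

lemma commutator_0:
  assumes "actf (psi (l + n)) v = 0" "phi (l + n) = 0"
  shows "actf (xp l) (actf (xm n) v) = actf (xm n) (actf (xp l) v)"
proof -
  have "actf (xp l * xm n - xm n * xp l) v = 0"
    unfolding actf_rel[OF xp_xm] using assms by (simp add: actf_mult actf_diff)
  then show ?thesis
    by (simp add: actf_diff actf_mult)
qed

text \<open>Each current has its own argument: the quadratic relation for \<open>xp\<close>, the
  exchange relation for \<open>psi\<close>, and for \<open>xm\<close> the commutator, whose right
  side vanishes on \<open>v\<close> for large modes.\<close>

lemma smooth_xp:
  assumes "smooth v"
  shows "smooth (actf (xp l) v)"
proof -
  have "ev_kills xp (actf (xp l) v)"
    using actf_rel[OF xp_xp] assms by (intro ev_kills_same_current) (auto simp: smooth_def)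
  moreover have "ev_kills psi (actf (xp l) v)"
    using actf_rel[OF psi_xp] assms by (intro ev_kills_psi_current) (auto simp: smooth_def)
  moreover have "\<forall>\<^sub>F n in at_top. actf (psi (l + n)) v = 0" "\<forall>\<^sub>F n in at_top. actf (xm n) v = 0"
    using assms ev_kills_shift by (auto simp: smooth_def ev_kills_def)
  then have "ev_kills xm (actf (xp l) v)"
    unfolding ev_kills_def using ev_phi_0[of l]
    by eventually_elim (metis commutator_0 add.commute actf_zero_right)
  ultimately show ?thesis
    by (simp add: smooth_def)
qed

lemma smooth_xm:
  assumes "smooth v"
  shows "smooth (actf (xm l) v)"
proof -
  have "ev_kills xm (actf (xm l) v)"
    using actf_rel[OF xm_xm] assms by (intro ev_kills_same_current) (auto simp: smooth_def)
  moreover have "ev_kills psi (actf (xm l) v)"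
    using actf_rel[OF psi_xm] assms by (intro ev_kills_psi_current) (auto simp: smooth_def)
  moreover have "\<forall>\<^sub>F n in at_top. actf (psi (n + l)) v = 0" "\<forall>\<^sub>F n in at_top. actf (xp n) v = 0"
    using assms ev_kills_shift by (auto simp: smooth_def ev_kills_def)
  then have "ev_kills xp (actf (xm l) v)"
    unfolding ev_kills_def using ev_phi_0[of l]
    by eventually_elim (metis commutator_0 actf_zero_right)
  ultimately show ?thesis
    by (simp add: smooth_def)
qed

text \<open>This serves the central elements \<open>Gam\<close>, \<open>GamInv\<close> and the
  scalars.\<close>

lemma smooth_commuting:
  assumes "smooth v" and "\<And>g. actf (fgen g) (actf x v) = actf x (actf (fgen g) v)"
  shows "smooth (actf x v)"
proof -
  have "actf (psi n) (actf x v) = actf x (actf (psi n) v)" for n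
    using assms(2) by (simp add: psi_def)
  then show ?thesis
    using assms unfolding smooth_def ev_kills_def by (auto elim: eventually_mono)
qed

lemma actf_Gam_GamInv: "actf (fgen Gam) (actf (fgen GamInv) v) = v"
    "actf (fgen GamInv) (actf (fgen Gam) v) = v"
  using actf_rel[OF gam_inv1, of v] actf_rel[OF gam_inv2, of v] by (simp_all add: actf_mult)

lemma actf_Gam_central: "actf (fgen Gam) (actf (fgen g) v) = actf (fgen g) (actf (fgen Gam) v)"
  using actf_rel[OF gam_central, of g v] by (simp add: actf_mult)

lemma smooth_gen:
  assumes "smooth v"
  shows "smooth (actf (fgen g) v)"
proof (cases g)
  case (Phi m)
  then show ?thesis
    using smooth_phi[OF assms, of m] by (simp add: phi_def)
next
  case (Psi m)
  then show ?thesis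
    using smooth_psi[OF assms, of m] by (simp add: psi_def)
next
  case Gam
  then show ?thesis
    using smooth_commuting[OF assms, of "fgen Gam"] actf_Gam_central by simp
next
  case GamInv
  \<comment> \<open>The relations state centrality for \<open>Gam\<close>; it passes to the inverse
    by inserting \<open>GamInv * Gam\<close> in front.\<close>
  have "actf (fgen h) (actf (fgen GamInv) v) = actf (fgen GamInv) (actf (fgen h) v)" for h
  proof -
    have "actf (fgen h) (actf (fgen GamInv) v) =
        actf (fgen GamInv) (actf (fgen Gam) (actf (fgen h) (actf (fgen GamInv) v)))"
      by (simp only: actf_Gam_GamInv)
    also have "\<dots> = actf (fgen GamInv) (actf (fgen h) (actf (fgen Gam) (actf (fgen GamInv) v)))"
      by (simp only: actf_Gam_central)
    finally show ?thesis
      by (simp only: actf_Gam_GamInv)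
  qed
  then show ?thesis
    using smooth_commuting[OF assms, of "fgen GamInv"] GamInv by simp
qed (use assms smooth_xp smooth_xm in auto)

lemma smooth_add:
  assumes "smooth v" "smooth w"
  shows "smooth (v + w)"
proof -
  have "ev_kills y (v + w)" if "ev_kills y v" "ev_kills y w" for y
    using that unfolding ev_kills_def by eventually_elim (simp add: actf_add_right)
  then show ?thesis
    using assms by (simp add: smooth_def)
qed

lemma smooth_actf:
  assumes "smooth v"
  shows "smooth (actf x v)"
proof (induction x rule: free_alg_induct)
  case zero
  show ?case by (simp add: smooth_def ev_kills_def)
next
  case (monomial c u)
  have "smooth (actf (Poly_Mapping.single (Word gs) 1) v)" for gs
  proof (induction gs)
    case Nil
    then show ?case using assms by (simp flip: zero_gword_def)
  next
    case (Cons g gs)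
    then show ?case by (simp add: single_word_Cons actf_mult smooth_gen)
  qed
  then have "smooth (actf (Poly_Mapping.single u 1) v)"
    by (metis gword.collapse)
  then have "smooth (actf (fconst c) (actf (Poly_Mapping.single u 1) v))"
    by (rule smooth_commuting) (metis actf_mult fconst_commute)
  then show ?case
    by (simp add: actf_mult)
next
  case (add a b)
  then show ?case by (simp add: actf_add smooth_add)
qed

end

section \<open>The highest weight vector\<close>

context level_integrable_module
begin

lemma xp_0_v0: "actf (xp 0) v0 = 0"
  using highest[of 1] by (simp add: chev_e_def act_gen)

lemma psi_0_v0: "\<exists>c. c \<noteq> 0 \<and> actf (psi 0) v0 = actf (fconst c) v0"
proof -
  obtain m where "act (chev_K 1) v0 = uq_scale act (qq ^ m) v0"
    using dominant_integral[of 1] by auto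
  then show ?thesis
    using qq_nonzero
    by (intro exI[of _ "qq ^ m"]) (simp add: chev_K_def act_gen psi_def uq_scale_eq_actf)
qed

text \<open>\<open>v0\<close> is an eigenvector of \<open>psi 0\<close> with nonzero eigenvalue, and
  scalars commute with \<open>x\<close>.\<close>

lemma annihilated_psi_0:
  assumes "actf x (actf (psi 0) v0) = 0"
  shows "actf x v0 = 0"
proof -
  obtain c where c: "c \<noteq> 0" "actf (psi 0) v0 = actf (fconst c) v0"
    using psi_0_v0 by blast
  have "actf (fconst c) (actf x v0) = 0"
    using assms c(2) by (metis actf_mult fconst_commute)
  then show ?thesis
    using actf_fconst_eq_0 c(1) by blast
qed

text \<open>The Chevalley generator \<open>e_0\<close> is \<open>xm 1 * phi 0\<close>. It also kills
  the multiple \<open>psi 0\<close> applied to \<open>v0\<close>, and there \<open>phi 0\<close>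
  cancels.\<close>

lemma xm_1_v0: "actf (xm 1) v0 = 0"
proof -
  obtain c where c: "actf (psi 0) v0 = actf (fconst c) v0"
    using psi_0_v0 by blast
  have "actf (xm 1 * phi 0) v0 = 0"
    using highest[of 0] by (simp add: chev_e_def act_mult act_gen actf_mult phi_def)
  then have "actf (xm 1 * phi 0) (actf (fconst c) v0) = 0"
    by (metis actf_mult actf_zero_right fconst_commute)
  then have "actf (xm 1) (actf (phi 0 * psi 0) v0) = 0"
    by (simp add: actf_mult c)
  then show ?thesis
    by (simp add: actf_rel[OF phi_psi_inv])
qed

lemma gam_actf_eq_0:
  assumes "actf (gam j) w = 0"
  shows "w = 0"
proof -
  have "w = 0" if "actf (fgen g ^ n) w = 0" "g = Gam \<or> g = GamInv" for n g
    using that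
  proof (induction n)
    case (Suc n)
    then show ?case
      by (metis actf_mult actf_Gam_GamInv actf_zero_right power_Suc)
  qed simp
  then show ?thesis
    using assms by (auto simp: gam_def split: if_splits)
qed

text \<open>Apply the commutator of \<open>xp 0\<close> and \<open>xm n\<close> to
  \<open>v0\<close>. Both products vanish and so does \<open>phi n\<close>, leaving an invertible
  multiple of \<open>psi n\<close>.\<close>

lemma psi_v0_of_xm:
  assumes "actf (xm n) v0 = 0" "n \<ge> 1"
  shows "actf (psi n) v0 = 0"
proof -
  let ?c = "1 / (qq - inverse qq)"
  have "qq - inverse qq \<noteq> 0"
    using qq_nonzero qq_power_4_neq_1 by (auto simp: field_simps power4_eq_xxxx)
  then have "?c \<noteq> 0"
    by simp
  moreover have "actf (fconst ?c) (actf (gam (0 - n)) (actf (psi (0 + n)) v0)) = 0"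
    using actf_rel[OF xp_xm[of 0 n], of v0] assms xp_0_v0
    by (simp add: actf_diff actf_mult phi_def)
  ultimately have "actf (psi (0 + n)) v0 = 0"
    using actf_fconst_eq_0 gam_actf_eq_0 by blast
  then show ?thesis
    by simp
qed

text \<open>\<open>\<psi>(1)\<close> raises the mode of \<open>x\<^sup>\<plusminus>\<close> by one, modulo multiples of \<open>x\<^sup>\<plusminus>(l) \<psi>(1)\<close>.\<close>
lemma raise_mode:
  assumes rel: "actf (psi (int 1) * y l) v0 =
      actf (\<Sum>j\<le>1. fconst (c j) * gam (s j) * y (l + int j) * psi (int 1 - int j)) v0"
    and c: "c 1 \<noteq> 0" and psi: "actf (psi 1) v0 = 0" and y: "actf (y l) v0 = 0"
  shows "actf (y (l + 1)) v0 = 0"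
proof (rule annihilated_psi_0)
  have "actf (fconst (c 1)) (actf (gam (s 1)) (actf (y (l + 1)) (actf (psi 0) v0))) = 0"
    using rel psi y by (simp add: actf_mult actf_add)
  then show "actf (y (l + 1)) (actf (psi 0) v0) = 0"
    using actf_fconst_eq_0 c gam_actf_eq_0 by blast
qed

text \<open>The generators \<open>e_1\<close> and \<open>e_0\<close> give the seeds
  \<open>xp 0\<close> and \<open>xm 1\<close>, hence \<open>psi 1\<close> kills \<open>v0\<close>.
  Then \<open>raise_mode\<close> climbs to all higher modes of both currents, and
  \<open>psi_v0_of_xm\<close> yields the higher modes of \<open>psi\<close>.\<close>

lemma smooth_v0: "smooth v0"
proof -
  have psi_1: "actf (psi 1) v0 = 0"
    using psi_v0_of_xm xm_1_v0 by simp
  have xp: "actf (xp n) v0 = 0" if "n \<ge> 0" for n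
    using that
  proof (induction n rule: int_ge_induct)
    case (step n)
    then show ?case
      using raise_mode[OF actf_rel[OF psi_xp]] g_ser_coeffs psi_1 by simp
  qed (rule xp_0_v0)
  have xm: "actf (xm n) v0 = 0" if "n \<ge> 1" for n
    using that
  proof (induction n rule: int_ge_induct)
    case (step n)
    then show ?case
      using raise_mode[OF actf_rel[OF psi_xm]] g_ser_coeffs psi_1 by simp
  qed (rule xm_1_v0)
  show ?thesis
    unfolding smooth_def ev_kills_def eventually_at_top_linorder using xp xm psi_v0_of_xm by blast
qed

lemma exists_actf: "\<exists>x. w = actf x v0"
proof -
  obtain a where "w = act a v0"
    using generated by blast
  then show ?thesis
    by (induction a rule: uq.abs_induct) (auto simp: actf_def)
qed

lemma xm_bound: "\<exists>N. \<forall>n\<ge>N. act (uq_gen (Xm n)) w = 0"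
proof -
  obtain x where "w = actf x v0"
    using exists_actf by blast
  then have "smooth w"
    using smooth_actf smooth_v0 by simp
  then show ?thesis
    by (simp add: smooth_def ev_kills_def eventually_at_top_linorder act_gen)
qed

section \<open>The support of the correlation functions\<close>

text \<open>Coefficient of \<open>z^-l w^-n\<close> in
  \<open>(q^2 z - w) F(z,w) = (z - q^2 w) F(w,z)\<close>, obtained from \<open>xm_xm\<close> by
  applying \<open>vs\<close> and multiplying by \<open>q^2\<close>.\<close>

lemma xm_xm_quadratic:
  "qq ^ 2 * correlation act vs w (l + 1) n - correlation act vs w l (n + 1) =
   correlation act vs w n (l + 1) - qq ^ 2 * correlation act vs w (n + 1) l"
  if "vs \<in> restricted_dual act v0"
proof -
  interpret f: Vector_Spaces.linear "uq_scale act" "(*)" vs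
    using that by (simp add: restricted_dual_def)
  have "vs (actf (xm (l + 1) * xm n - fconst (inverse qq ^ 2) * xm l * xm (n + 1)) w) =
      vs (actf (fconst (inverse qq ^ 2) * xm n * xm (l + 1) - xm (n + 1) * xm l) w)"
    by (simp only: actf_rel[OF xm_xm])
  then have "correlation act vs w (l + 1) n - inverse qq ^ 2 * correlation act vs w l (n + 1) =
      inverse qq ^ 2 * correlation act vs w n (l + 1) - correlation act vs w (n + 1) l"
    by (simp add: actf_diff actf_mult f.diff f.scale correlation_def act_gen flip: uq_scale_eq_actf)
  then have "qq ^ 2 * (correlation act vs w (l + 1) n - inverse qq ^ 2 * correlation act vs w l (n + 1)) =
      qq ^ 2 * (inverse qq ^ 2 * correlation act vs w n (l + 1) - correlation act vs w (n + 1) l)"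
    by simp
  then show ?thesis
    using qq_nonzero by (simp add: right_diff_distrib power_inverse flip: mult.assoc)
qed

text \<open>On a word applied to \<open>v0\<close> the modes \<open>l\<close> and \<open>n\<close>
  shift the \<open>\<delta>\<close>-degree by \<open>l + n\<close>, and \<open>vs\<close> sees only
  finitely many weights. General vectors are finite combinations of such.\<close>

lemma correlation_total_degree:
  assumes "vs \<in> restricted_dual act v0"
  shows "\<exists>S. finite S \<and> (\<forall>l n. l + n \<notin> S \<longrightarrow> correlation act vs w l n = 0)"
proof -
  interpret f: Vector_Spaces.linear "uq_scale act" "(*)" vs
    using assms by (simp add: restricted_dual_def)
  define B where "B = {\<beta>. \<exists>w\<in>weight_space act v0 \<beta>. vs w \<noteq> 0}"
  have B: "finite B"
    using assms by (simp add: restricted_dual_def B_def)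
  have word: "vs (actf (Poly_Mapping.single u 1) v0) = 0" if "word_weight u \<notin> B" for u
  proof -
    have "actf (Poly_Mapping.single u 1) v0 \<in> weight_space act v0 (word_weight u)"
      unfolding weight_space_def by (intro f.vs1.span_base) (auto simp: act_word)
    then show ?thesis
      using that by (auto simp: B_def)
  qed
  obtain x where x: "w = actf x v0"
    using exists_actf by blast
  have "\<exists>S. finite S \<and> (\<forall>l n. l + n \<notin> S \<longrightarrow> correlation act vs (actf x v0) l n = 0)"
  proof (induction x rule: free_alg_induct)
    case zero
    show ?case by (intro exI[of _ "{}"]) (simp add: correlation_def act_gen f.zero)
  next
    case (monomial c u)
    let ?d = "snd (word_weight u)"
    have "correlation act vs (actf (fconst c * Poly_Mapping.single u 1) v0) l n = 0"
      if "l + n \<notin> (\<lambda>\<beta>. snd \<beta> - ?d) ` B" for l n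
    proof -
      let ?u = "Word (Xm l # Xm n # letters u)"
      have "snd (word_weight ?u) - ?d = l + n"
        by (simp add: word_weight_def)
      then have "word_weight ?u \<notin> B"
        using that by force
      moreover have "xm l * (xm n * (fconst c * Poly_Mapping.single u 1)) =
          fconst c * Poly_Mapping.single ?u 1"
        by (simp add: fgen_def fconst_def mult_single plus_gword_def zero_gword_def)
      then have "correlation act vs (actf (fconst c * Poly_Mapping.single u 1) v0) l n =
          vs (actf (fconst c * Poly_Mapping.single ?u 1) v0)"
        by (simp add: correlation_def act_gen flip: actf_mult)
      ultimately show ?thesis
        by (simp add: actf_mult f.scale word flip: uq_scale_eq_actf)
    qed
    then show ?case
      using B by (intro exI[of _ "(\<lambda>\<beta>. snd \<beta> - ?d) ` B"]) auto
  next
    case (add a b)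
    then obtain S T where "finite S" "\<forall>l n. l + n \<notin> S \<longrightarrow> correlation act vs (actf a v0) l n = 0"
      "finite T" "\<forall>l n. l + n \<notin> T \<longrightarrow> correlation act vs (actf b v0) l n = 0"
      by blast
    then show ?case
      by (intro exI[of _ "S \<union> T"]) (simp add: correlation_def act_gen actf_add actf_add_right f.add)
  qed
  then show ?thesis
    by (simp add: x)
qed

end

section \<open>Laurent series with a single linear denominator\<close>

lemma nth_poly_fls_X_inv:
  "fls_nth (poly (map_poly fls_const c) fls_X_inv) l = (if l \<le> 0 then coeff c (nat (- l)) else 0)"
  for c :: "'a::comm_ring_1 poly"
proof (induction c arbitrary: l)
  case (pCons x c)
  then show ?case
    by (auto simp: map_poly_pCons fls_X_inv_times_conv_shift coeff_pCons nat_diff_distrib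
        split: nat.splits)
qed simp

lemma nth_laurent_of_poly:
  "fls_nth (laurent_of_poly p) m =
   (if m \<ge> 0 then poly (map_poly fls_const (coeff p (nat m))) fls_X_inv else 0)"
proof (induction p arbitrary: m)
  case (pCons c p)
  then show ?case
    by (auto simp: laurent_of_poly_def map_poly_pCons fls_X_times_conv_shift coeff_pCons
        nat_diff_distrib split: nat.splits)
qed (simp add: laurent_of_poly_def)

text \<open>\<open>m\<close> is the exponent of \<open>w\<close> and \<open>l\<close> that of the
  inverse of \<open>z\<close>, hence the sign in front of \<open>l\<close>.\<close>

lemma nth_nth_laurent_of_poly:
  "fls_nth (fls_nth (laurent_of_poly p) m) l =
   (if m \<ge> 0 \<and> l \<le> 0 then coeff (coeff p (nat m)) (nat (- l)) else 0)"
  by (simp add: nth_laurent_of_poly nth_poly_fls_X_inv)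

lemma laurent_of_poly_diff: "laurent_of_poly (p - q) = laurent_of_poly p - laurent_of_poly q"
  by (intro fls_eqI) (simp add: nth_nth_laurent_of_poly)

lemma laurent_of_poly_monom:
  "laurent_of_poly (monom (monom c i) j) = fls_const (fls_const c * fls_X_inv ^ i) * fls_X ^ j"
  by (simp add: laurent_of_poly_def map_poly_monom poly_monom)

lemma eval2_diff: "eval2 (p - q) z w = eval2 p z w - eval2 q z w"
proof -
  have inner: "map_poly to_ac (a - b) = map_poly to_ac a - map_poly to_ac b" for a b :: "base poly"
    by (rule poly_eqI) (simp add: coeff_map_poly)
  have "map_poly (\<lambda>c. poly (map_poly to_ac c) z) (p - q) =
      map_poly (\<lambda>c. poly (map_poly to_ac c) z) p - map_poly (\<lambda>c. poly (map_poly to_ac c) z) q"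
    by (rule poly_eqI) (simp add: coeff_map_poly inner)
  then show ?thesis
    by (simp add: eval2_def)
qed

lemma eval2_monom: "eval2 (monom (monom c i) j) z w = to_ac c * z ^ i * w ^ j"
  by (simp add: eval2_def map_poly_monom poly_monom)

text \<open>\<open>z\<^sup>D w\<^sup>D (c z - w)\<close>\<close>
definition linear_denom :: "base \<Rightarrow> nat \<Rightarrow> base poly poly" where
  "linear_denom c D = monom (monom c (Suc D)) D - monom (monom 1 D) (Suc D)"

text \<open>The coefficient of \<open>z^(D+1) w^D\<close> is \<open>c\<close>.\<close>

lemma laurent_linear_denom_nonzero:
  assumes "c \<noteq> 0"
  shows "laurent_of_poly (linear_denom c D) \<noteq> 0"
proof
  assume "laurent_of_poly (linear_denom c D) = 0"
  then have "fls_nth (fls_nth (laurent_of_poly (linear_denom c D)) (int D)) (- int (Suc D)) = 0"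
    by simp
  then show False
    using assms by (simp add: nth_nth_laurent_of_poly linear_denom_def nat_add_distrib)
qed

lemma linear_denom_nonzero:
  assumes "c \<noteq> 0"
  shows "linear_denom c D \<noteq> 0"
  using laurent_linear_denom_nonzero[OF assms, of D] by (auto simp: laurent_of_poly_def)

text \<open>The given denominator must vanish at a pole, and its monomial factor does not when
  \<open>z\<close> and \<open>w\<close> are nonzero.\<close>

lemma pole_at_linear_denom:
  assumes "pole_at (Fract a (linear_denom c D)) z w" "c \<noteq> 0" "z \<noteq> 0" "w \<noteq> 0"
  shows "z * to_ac c = w"
proof -
  have "eval2 (linear_denom c D) z w = 0"
    using assms(1) linear_denom_nonzero[OF assms(2)] by (auto simp: pole_at_def)
  then have "z ^ D * w ^ D * (z * to_ac c - w) = 0"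
    by (simp add: linear_denom_def eval2_diff eval2_monom algebra_simps)
  then show ?thesis
    using assms by simp
qed

text \<open>Multiplying by \<open>c z - w\<close> leaves coefficients supported where both modes are
  below \<open>N\<close> and the total degree is bounded below, hence a Laurent polynomial; the
  factor \<open>z^D w^D\<close> then clears negative powers.\<close>

lemma is_expansion_linear_denom:
  fixes F :: "int \<Rightarrow> int \<Rightarrow> base"
  assumes c: "c \<noteq> 0" and S: "finite S"
    and deg: "\<And>l n. l + n \<notin> S \<Longrightarrow> F l n = 0"
    and F0: "\<And>l n. n \<ge> N \<Longrightarrow> F l n = 0"
    and H0: "\<And>l n. l \<ge> N \<Longrightarrow> c * F (l + 1) n - F l (n + 1) = 0"
  shows "\<exists>a D. is_expansion F (Fract a (linear_denom c D))"
proof -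
  define H where "H l n = c * F (l + 1) n - F l (n + 1)" for l n
  obtain M where M: "- M \<le> s" if "s \<in> S" for s
    using Min_le[OF S] by (metis minus_minus)
  have F1: "F l n = 0" if "l + n < - M" for l n
    using deg M that by (meson not_less)
  \<comment> \<open>If \<open>l < N\<close>, \<open>n < N\<close> and
    \<open>l + n + 1 >= - M\<close>, then both modes lie between \<open>- D\<close> and
    \<open>D\<close>.\<close>
  define D where "D = nat (\<bar>M\<bar> + \<bar>N\<bar> + 1)"
  have H: "H l n = 0" if "\<not> (\<bar>l\<bar> \<le> int D \<and> \<bar>n\<bar> \<le> int D)" for l n
  proof -
    have "int D = \<bar>M\<bar> + \<bar>N\<bar> + 1"
      by (simp add: D_def)
    then have "l \<ge> N \<or> n \<ge> N \<or> l + n + 1 < - M"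
      using that by arith
    then consider "l \<ge> N" | "n \<ge> N" | "l + n + 1 < - M"
      by blast
    then show ?thesis
      by cases (auto simp: H_def F0 F1 H0)
  qed
  \<comment> \<open>The exponent of \<open>w\<close> is \<open>m = - n\<close>. Both uses of
    \<open>Abs_fls\<close> need support bounded below: for fixed \<open>n\<close> this comes from
    the total degree, for \<open>m\<close> from \<open>n < N\<close>.\<close>
  define f where "f = Abs_fls (\<lambda>m. Abs_fls (\<lambda>l. F l (- m)))"
  have inner: "fls_nth (Abs_fls (\<lambda>l. F l n)) l = F l n" for l n
    by (rule nth_Abs_fls_lower_bound[of "- M - n"]) (simp add: F1)
  have "fls_nth f m = Abs_fls (\<lambda>l. F l (- m))" for m
    unfolding f_def by (rule nth_Abs_fls_lower_bound[of "- N"])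
      (auto intro!: fls_eqI simp: inner F0)
  then have f: "fls_nth (fls_nth f m) l = F l (- m)" for m l
    by (simp add: inner)
  \<comment> \<open>This is \<open>z^D w^D\<close> times the Laurent polynomial with coefficients
    \<open>H\<close>; modes in \<open>[- D, D]\<close> become exponents \<open>D - l\<close> and
    \<open>D - n\<close> in \<open>[0, 2 D]\<close>.\<close>
  define a where "a = (\<Sum>i\<le>2 * D. monom (\<Sum>j\<le>2 * D. monom (H (int D - int j) (int D - int i)) j) i)"
  let ?b = "linear_denom c D"
  have "laurent_of_poly ?b * f = laurent_of_poly a"
  proof (intro fls_eqI)
    fix m l
    have "laurent_of_poly ?b * f =
        fls_const (fls_const c * fls_X_inv ^ Suc D) * (fls_X ^ D * f) -
        fls_const (fls_X_inv ^ D) * (fls_X ^ Suc D * f)"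
      by (simp only: linear_denom_def laurent_of_poly_diff laurent_of_poly_monom
          left_diff_distrib mult.assoc fls_const_1 mult_1_left)
    then have "fls_nth (laurent_of_poly ?b * f) m =
        fls_const c * (fls_X_inv ^ Suc D * fls_nth f (m - int D)) -
        fls_X_inv ^ D * fls_nth f (m + (- 1 - int D))"
      by (simp add: fls_X_power_times_conv_shift mult.assoc del: power_Suc)
    then have "fls_nth (fls_nth (laurent_of_poly ?b * f) m) l =
        c * F (l + int D + 1) (int D - m) - F (l + int D) (int D - m + 1)"
      by (simp add: fls_X_inv_power_times_conv_shift f del: power_Suc) (simp add: algebra_simps)
    then have "fls_nth (fls_nth (laurent_of_poly ?b * f) m) l = H (l + int D) (int D - m)"
      by (simp add: H_def)
    moreover have "fls_nth (fls_nth (laurent_of_poly a) m) l = H (l + int D) (int D - m)"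
    proof (cases "m \<ge> 0 \<and> l \<le> 0 \<and> nat m \<le> 2 * D \<and> nat (- l) \<le> 2 * D")
      case True
      then show ?thesis
        by (simp add: nth_nth_laurent_of_poly a_def coeff_sum if_distrib[of "\<lambda>p. coeff p _"]
            algebra_simps cong: if_cong)
    next
      case False
      then have "H (l + int D) (int D - m) = 0"
        by (intro H) auto
      moreover have "coeff (coeff a (nat m)) (nat (- l)) = 0" if "m \<ge> 0" "l \<le> 0"
        using False that by (auto simp: a_def coeff_sum if_distrib[of "\<lambda>p. coeff p _"] cong: if_cong)
      ultimately show ?thesis
        by (auto simp: nth_nth_laurent_of_poly)
    qed
    ultimately show "fls_nth (fls_nth (laurent_of_poly ?b * f) m) l =
        fls_nth (fls_nth (laurent_of_poly a) m) l"
      by simp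
  qed
  then have "laurent_of_poly a / laurent_of_poly ?b = f"
    using laurent_linear_denom_nonzero[OF c, of D] by (simp add: field_simps)
  then have "is_expansion F (Fract a ?b)"
    unfolding is_expansion_def using linear_denom_nonzero[OF c, of D]
    by (intro exI[of _ a] exI[of _ ?b]) (simp add: f)
  then show ?thesis
    by blast
qed

theorem proposition6:
  fixes act :: "uq \<Rightarrow> 'v::ab_group_add \<Rightarrow> 'v"
    and k :: nat and v0 v :: 'v and vs :: "'v \<Rightarrow> base"
  assumes "k \<ge> 1"
    and "level_integrable_module act k v0"
    and "vs \<in> restricted_dual act v0"
  shows "\<exists>R. is_expansion (correlation act vs v) R \<and>
           (\<forall>z w. z \<noteq> 0 \<longrightarrow> w \<noteq> 0 \<longrightarrow> pole_at R z w \<longrightarrow> z * to_ac (qq ^ 2) = w)"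
proof -
  interpret level_integrable_module act k v0 by fact
  let ?F = "correlation act vs v"
  interpret f: Vector_Spaces.linear "uq_scale act" "(*)" vs
    using assms(3) by (simp add: restricted_dual_def)
  obtain S where S: "finite S" "\<And>l n. l + n \<notin> S \<Longrightarrow> ?F l n = 0"
    using correlation_total_degree[OF assms(3)] by blast
  obtain N where "\<forall>n\<ge>N. act (uq_gen (Xm n)) v = 0"
    using xm_bound by blast
  then have N: "?F l n = 0" if "n \<ge> N" for l n
    using that by (simp add: correlation_def act_gen f.zero)
  have c: "qq ^ 2 \<noteq> 0"
    using qq_nonzero by simp
  \<comment> \<open>On the right of the quadratic relation the modes acting first on
    \<open>v\<close> are \<open>l + 1\<close> and \<open>l\<close>, so both terms vanish for
    \<open>l >= N\<close>.\<close>
  have "qq ^ 2 * ?F (l + 1) n - ?F l (n + 1) = 0" if "l \<ge> N" for l n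
    using that by (simp add: xm_xm_quadratic[OF assms(3)] N)
  then obtain a D where "is_expansion ?F (Fract a (linear_denom (qq ^ 2) D))"
    using is_expansion_linear_denom[OF c S(1), of ?F N] S(2) N by blast
  then show ?thesis
    using pole_at_linear_denom c by blast
qed

end
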